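(* A ring $R$ is J-clean-like if and only if the following three conditions hold: (1) $R/J(R)$ is periodic; (2) $R$ is right quasi-duo; (3) every potent element lifts modulo $J(R)$. The same equivalence holds with "right quasi-duo" replaced by "left quasi-duo" in (2).
   Context: All rings are associative with identity. $J(R)$ is the Jacobson radical of $R$. An element $p\in R$ is potent if $p=p^m$ for some integer $m\ge 2$. A ring $R$ is J-clean-like if for every $a\in R$ there exists a potent $p\in R$ such that $a-p\in J(R)$. A ring $R$ is periodic if for every $a\in R$ there exist distinct positive integers $m,n$ with $a^m=a^n$. A ring is right (resp. left) quasi-duo if every maximal right (resp. left) ideal is a two-sided ideal. "Every potent element lifts modulo $J(R)$" means: whenever $p\in R$ satisfies $p-p^n\in J(R)$ for some $n\ge 2$, there exists a potent $q\in R$ with $p-q\in J(R)$. *)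

theory Defs
  imports "HOL-Algebra.QuotRing"
begin

text \<open>
  Rings are those of the locale \<^locale>\<open>ring\<close>: associative with identity, not necessarily
  commutative, the zero ring included. The library only has two-sided ideals, so the
  one-sided notions are set up here in the style of \<^locale>\<open>ideal\<close> and
  \<^locale>\<open>maximalideal\<close>.
\<close>

locale right_ideal = additive_subgroup I R + ring R for I and R (structure) +
  assumes I_r_closed: "\<lbrakk>a \<in> I; x \<in> carrier R\<rbrakk> \<Longrightarrow> a \<otimes> x \<in> I"

locale left_ideal = additive_subgroup I R + ring R for I and R (structure) +
  assumes I_l_closed: "\<lbrakk>a \<in> I; x \<in> carrier R\<rbrakk> \<Longrightarrow> x \<otimes> a \<in> I"

locale maximal_right_ideal = right_ideal +
  assumes I_notcarr: "carrier R \<noteq> I"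
    and I_maximal: "\<lbrakk>right_ideal J R; I \<subseteq> J; J \<subseteq> carrier R\<rbrakk> \<Longrightarrow> J = I \<or> J = carrier R"

locale maximal_left_ideal = left_ideal +
  assumes I_notcarr: "carrier R \<noteq> I"
    and I_maximal: "\<lbrakk>left_ideal J R; I \<subseteq> J; J \<subseteq> carrier R\<rbrakk> \<Longrightarrow> J = I \<or> J = carrier R"

text \<open>
  The intersection of all maximal right ideals. In any ring it is a two-sided ideal and equals
  the intersection of all maximal left ideals. In the zero ring, which has no maximal right
  ideals, the intersection is taken inside the carrier, so the radical is the whole ring.
\<close>

definition jacobson_radical :: "('a, 'b) ring_scheme \<Rightarrow> 'a set" where
  "jacobson_radical R = {x \<in> carrier R. \<forall>M. maximal_right_ideal M R \<longrightarrow> x \<in> M}"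

definition potent :: "('a, 'b) ring_scheme \<Rightarrow> 'a \<Rightarrow> bool" where
  "potent R p \<longleftrightarrow> p \<in> carrier R \<and> (\<exists>m::nat. m \<ge> 2 \<and> p = p [^]\<^bsub>R\<^esub> m)"

definition J_clean_like :: "('a, 'b) ring_scheme \<Rightarrow> bool" where
  "J_clean_like R \<longleftrightarrow>
     (\<forall>a \<in> carrier R. \<exists>p. potent R p \<and> a \<ominus>\<^bsub>R\<^esub> p \<in> jacobson_radical R)"

definition periodic_ring :: "('a, 'b) ring_scheme \<Rightarrow> bool" where
  "periodic_ring R \<longleftrightarrow>
     (\<forall>a \<in> carrier R. \<exists>m n :: nat. m > 0 \<and> n > 0 \<and> m \<noteq> n \<and> a [^]\<^bsub>R\<^esub> m = a [^]\<^bsub>R\<^esub> n)"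

definition right_quasi_duo :: "('a, 'b) ring_scheme \<Rightarrow> bool" where
  "right_quasi_duo R \<longleftrightarrow> (\<forall>M. maximal_right_ideal M R \<longrightarrow> ideal M R)"

definition left_quasi_duo :: "('a, 'b) ring_scheme \<Rightarrow> bool" where
  "left_quasi_duo R \<longleftrightarrow> (\<forall>M. maximal_left_ideal M R \<longrightarrow> ideal M R)"

definition potents_lift_mod_J :: "('a, 'b) ring_scheme \<Rightarrow> bool" where
  "potents_lift_mod_J R \<longleftrightarrow>
     (\<forall>p \<in> carrier R. \<forall>n::nat. n \<ge> 2 \<longrightarrow> p \<ominus>\<^bsub>R\<^esub> p [^]\<^bsub>R\<^esub> n \<in> jacobson_radical R \<longrightarrow>
        (\<exists>q. potent R q \<and> p \<ominus>\<^bsub>R\<^esub> q \<in> jacobson_radical R))"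

end

theory Submission
  imports Defs "HOL-Algebra.Multiplicative_Group"
begin

text \<open>
  Let \<open>J\<close> be the Jacobson radical. If \<open>R\<close> is J-clean-like, every element of \<open>R/J\<close> is potent, so
  \<open>R/J\<close> is reduced, its idempotents are central, and its right ideals are two-sided; as \<open>J\<close> lies in
  every maximal right ideal, \<open>R\<close> is right quasi-duo. Conversely, if \<open>R\<close> is right quasi-duo, every
  maximal right ideal is completely prime, so \<open>a\<^sup>m (1 - a\<^sup>k) \<in> J\<close> implies \<open>a (1 - a\<^sup>k) \<in> J\<close>, and the
  potent element \<open>a + J\<close> lifts. The left-handed version is the right-handed one for the opposite
  ring, which has the same radical.
\<close>

subsection \<open>Maximal right ideals\<close>

context ring
begin

text \<open>Negatives come from right absorption, since
  \<open>\<ominus> a = a \<otimes> \<ominus> \<one>\<close>. Later proofs that a set is a right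
  ideal check only these four conditions.\<close>

lemma right_ideal_iff:
  "right_ideal I R \<longleftrightarrow>
     I \<subseteq> carrier R \<and> \<zero> \<in> I \<and> (\<forall>a\<in>I. \<forall>b\<in>I. a \<oplus> b \<in> I) \<and> (\<forall>a\<in>I. \<forall>x\<in>carrier R. a \<otimes> x \<in> I)"
    (is "_ \<longleftrightarrow> ?P")
proof
  assume "right_ideal I R"
  then interpret right_ideal I R .
  show ?P
    using a_subset I_r_closed by (auto intro: a_closed)
next
  assume P: ?P
  have neg: "\<ominus> a \<in> I" if "a \<in> I" for a
  proof -
    have "a \<otimes> \<ominus> \<one> = \<ominus> a"
      using that P by (auto simp: r_minus)
    then show ?thesis
      using that P by (metis a_inv_closed one_closed)
  qed
  have "subgroup I (add_monoid R)"
    using P neg by (auto intro!: add.subgroupI simp: a_inv_def)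
  then show "right_ideal I R"
    using P by (simp add: right_ideal.intro right_ideal_axioms.intro additive_subgroupI ring_axioms)
qed

lemma right_idealI:
  assumes "I \<subseteq> carrier R" "\<zero> \<in> I" "\<And>a b. a \<in> I \<Longrightarrow> b \<in> I \<Longrightarrow> a \<oplus> b \<in> I"
    and "\<And>a x. a \<in> I \<Longrightarrow> x \<in> carrier R \<Longrightarrow> a \<otimes> x \<in> I"
  shows "right_ideal I R"
  using assms by (simp add: right_ideal_iff)

lemma right_ideal_mult_image:
  assumes "x \<in> carrier R"
  shows "right_ideal ((\<otimes>) x ` carrier R) R"
proof -
  have "x \<otimes> a \<oplus> x \<otimes> b = x \<otimes> (a \<oplus> b)" "x \<otimes> a \<otimes> b = x \<otimes> (a \<otimes> b)"
    if "a \<in> carrier R" "b \<in> carrier R" for a b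
    using assms that by (simp_all add: r_distr m_assoc)
  moreover have "\<zero> \<in> (\<otimes>) x ` carrier R"
    using assms by (intro image_eqI[of _ _ \<zero>]) simp_all
  ultimately show ?thesis
    unfolding right_ideal_iff using assms by auto
qed

text \<open>The sum \<open>I + xR\<close>, the smallest right ideal containing \<open>I\<close> and
  \<open>x\<close>; maximality is tested against it below.\<close>

lemma right_ideal_add_mult_image:
  assumes "right_ideal I R" "x \<in> carrier R"
  shows "right_ideal {m \<oplus> x \<otimes> r | m r. m \<in> I \<and> r \<in> carrier R} R" (is "right_ideal ?K R")
proof -
  have I: "I \<subseteq> carrier R" "\<zero> \<in> I" "\<And>a b. a \<in> I \<Longrightarrow> b \<in> I \<Longrightarrow> a \<oplus> b \<in> I"
    "\<And>a r. a \<in> I \<Longrightarrow> r \<in> carrier R \<Longrightarrow> a \<otimes> r \<in> I"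
    using assms(1) by (auto simp: right_ideal_iff)
  have "?K \<subseteq> carrier R"
    using I(1) assms(2) by auto
  moreover have "\<zero> \<in> ?K"
  proof -
    have "\<zero> = \<zero> \<oplus> x \<otimes> \<zero>"
      using assms(2) by simp
    then show ?thesis
      using I(2) by blast
  qed
  moreover have "a \<oplus> b \<in> ?K" if ab: "a \<in> ?K" "b \<in> ?K" for a b
  proof -
    obtain m r m' r' where a: "a = m \<oplus> x \<otimes> r" "m \<in> I" "r \<in> carrier R"
      and b: "b = m' \<oplus> x \<otimes> r'" "m' \<in> I" "r' \<in> carrier R"
      using ab by blast
    have "m \<in> carrier R" "m' \<in> carrier R"
      using a(2) b(2) I(1) by auto
    then have "a \<oplus> b = (m \<oplus> m') \<oplus> x \<otimes> (r \<oplus> r')"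
      using a b assms(2) by (simp add: r_distr a_ac)
    moreover have "m \<oplus> m' \<in> I" "r \<oplus> r' \<in> carrier R"
      using a b I(3) by simp_all
    ultimately show ?thesis
      by blast
  qed
  moreover have "a \<otimes> s \<in> ?K" if "a \<in> ?K" "s \<in> carrier R" for a s
  proof -
    obtain m r where a: "a = m \<oplus> x \<otimes> r" "m \<in> I" "r \<in> carrier R"
      using \<open>a \<in> ?K\<close> by blast
    have "m \<in> carrier R"
      using a(2) I(1) by auto
    then have "a \<otimes> s = m \<otimes> s \<oplus> x \<otimes> (r \<otimes> s)"
      using a assms(2) that(2) by (simp add: l_distr m_assoc)
    moreover have "m \<otimes> s \<in> I" "r \<otimes> s \<in> carrier R"
      using a I(4) that(2) by simp_all
    ultimately show ?thesis
      by blast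
  qed
  ultimately show ?thesis
    by (rule right_idealI)
qed

lemma right_ideal_one_imp_carrier:
  assumes "right_ideal I R" "\<one> \<in> I"
  shows "I = carrier R"
proof -
  have "x \<in> I" if "x \<in> carrier R" for x
    using assms that l_one[OF that] unfolding right_ideal_iff by metis
  then show ?thesis
    using assms(1) by (auto simp: right_ideal_iff)
qed

text \<open>Zorn's lemma on the right ideals above \<open>I\<close> that avoid
  \<open>\<one>\<close>. Properness is phrased through \<open>\<one>\<close> because that survives
  unions of chains.\<close>

lemma exists_maximal_right_ideal:
  assumes "right_ideal I R" "\<one> \<notin> I"
  obtains M where "maximal_right_ideal M R" "I \<subseteq> M"
proof -
  let ?A = "{J. right_ideal J R \<and> \<one> \<notin> J \<and> I \<subseteq> J}"
  have "\<exists>M\<in>?A. \<forall>X\<in>?A. M \<subseteq> X \<longrightarrow> X = M"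
  proof (rule subset_Zorn_nonempty)
    show "?A \<noteq> {}"
      using assms by blast
  next
    fix C
    assume C: "C \<noteq> {}" "subset.chain ?A C"
    then have CA: "\<And>X. X \<in> C \<Longrightarrow> X \<in> ?A"
      and total: "\<And>X Y. X \<in> C \<Longrightarrow> Y \<in> C \<Longrightarrow> X \<subseteq> Y \<or> Y \<subseteq> X"
      by (auto simp: subset_chain_def)
    \<comment> \<open>Two members of a chain are comparable, so both summands lie in the larger
      one.\<close>
    have "a \<oplus> b \<in> \<Union>C" if ab: "a \<in> \<Union>C" "b \<in> \<Union>C" for a b
    proof -
      obtain Y Z where YZ: "Y \<in> C" "Z \<in> C" "a \<in> Y" "b \<in> Z"
        using ab by auto
      then obtain X where "X \<in> C" "a \<in> X" "b \<in> X"
        using total[OF YZ(1,2)] by auto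
      then show ?thesis
        using CA[of X] by (auto simp: right_ideal_iff)
    qed
    moreover have "\<zero> \<in> \<Union>C"
      using C(1) CA by (auto simp: right_ideal_iff)
    moreover have "\<Union>C \<subseteq> carrier R" "\<forall>a\<in>\<Union>C. \<forall>x\<in>carrier R. a \<otimes> x \<in> \<Union>C"
      using CA by (auto simp: right_ideal_iff) blast+
    ultimately have "right_ideal (\<Union>C) R"
      by (simp add: right_ideal_iff)
    moreover have "\<one> \<notin> \<Union>C" "I \<subseteq> \<Union>C"
      using C(1) CA by auto
    ultimately show "\<Union>C \<in> ?A"
      by simp
  qed
  then obtain M where MA: "M \<in> ?A" and max: "\<forall>X\<in>?A. M \<subseteq> X \<longrightarrow> X = M"
    by (rule bexE)
  then have M: "right_ideal M R" "\<one> \<notin> M" "I \<subseteq> M"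
    by simp_all
  have "maximal_right_ideal M R"
  proof (intro maximal_right_ideal.intro maximal_right_ideal_axioms.intro)
    show "right_ideal M R" "carrier R \<noteq> M"
      using M by auto
  next
    fix J
    assume "right_ideal J R" "M \<subseteq> J" "J \<subseteq> carrier R"
    \<comment> \<open>If \<open>\<one> \<notin> J\<close>, then \<open>J\<close> competes in the
      Zorn family and equals \<open>M\<close>; otherwise it is the whole ring.\<close>
    then show "J = M \<or> J = carrier R"
      using bspec[OF max, of J] M(3) right_ideal_one_imp_carrier[of J] by auto
  qed
  with M(3) show ?thesis
    using that by blast
qed

lemma maximal_right_ideal_D:
  assumes "maximal_right_ideal M R"
  shows "right_ideal M R" "\<one> \<notin> M" "M \<subseteq> carrier R" "\<zero> \<in> M"
    and "\<And>a b. a \<in> M \<Longrightarrow> b \<in> M \<Longrightarrow> a \<oplus> b \<in> M"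
    and "\<And>a r. a \<in> M \<Longrightarrow> r \<in> carrier R \<Longrightarrow> a \<otimes> r \<in> M"
proof -
  interpret maximal_right_ideal M R by fact
  show *: "right_ideal M R"
    by unfold_locales
  show "\<one> \<notin> M"
    using right_ideal_one_imp_carrier[OF *] I_notcarr by blast
  show "M \<subseteq> carrier R" "\<zero> \<in> M" "\<And>a b. a \<in> M \<Longrightarrow> b \<in> M \<Longrightarrow> a \<oplus> b \<in> M"
    "\<And>a r. a \<in> M \<Longrightarrow> r \<in> carrier R \<Longrightarrow> a \<otimes> r \<in> M"
    using * by (auto simp: right_ideal_iff)
qed

text \<open>\<open>M + xR\<close> is strictly larger than \<open>M\<close>, hence is the whole ring
  and contains \<open>\<one>\<close>.\<close>

lemma maximal_right_ideal_comaximal: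
  assumes "maximal_right_ideal M R" "x \<in> carrier R" "x \<notin> M"
  obtains m r where "m \<in> M" "r \<in> carrier R" "\<one> = m \<oplus> x \<otimes> r"
proof -
  interpret maximal_right_ideal M R by fact
  note M = maximal_right_ideal_D[OF assms(1)]
  let ?K = "{m \<oplus> x \<otimes> r | m r. m \<in> M \<and> r \<in> carrier R}"
  have K: "right_ideal ?K R"
    using right_ideal_add_mult_image M(1) assms(2) by blast
  have "m \<in> ?K" if "m \<in> M" for m
  proof -
    have "m = m \<oplus> x \<otimes> \<zero>"
      using that M(3) assms(2) by auto
    then show ?thesis
      using that by blast
  qed
  moreover have "x \<in> ?K"
  proof -
    have "x = \<zero> \<oplus> x \<otimes> \<one>"
      using assms(2) by simp
    then show ?thesis
      using M(4) by blast
  qed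
  moreover have "?K \<subseteq> carrier R"
    using K by (simp add: right_ideal_iff)
  ultimately have "?K = carrier R"
    using I_maximal[OF K] assms(3) by blast
  then show ?thesis
    using that by blast
qed

end

subsection \<open>Left-right symmetry of the Jacobson radical\<close>

context ring
begin

text \<open>If \<open>(1 - x)R\<close> were proper, a maximal right ideal above it would contain
  both \<open>1 - x\<close> and \<open>x\<close>, hence \<open>\<one>\<close>.\<close>

lemma one_minus_mult_right_inverse:
  assumes x: "x \<in> jacobson_radical R"
  obtains u where "u \<in> carrier R" "(\<one> \<ominus> x) \<otimes> u = \<one>"
proof -
  have xc: "x \<in> carrier R"
    using x by (simp add: jacobson_radical_def)
  let ?I = "(\<otimes>) (\<one> \<ominus> x) ` carrier R"
  have I: "right_ideal ?I R"
    using right_ideal_mult_image xc by simp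
  have "\<one> \<in> ?I"
  proof (rule ccontr)
    assume "\<one> \<notin> ?I"
    then obtain M where M: "maximal_right_ideal M R" "?I \<subseteq> M"
      using exists_maximal_right_ideal[OF I] by blast
    have "(\<one> \<ominus> x) \<otimes> \<one> \<in> M"
      using M(2) by blast
    moreover have "x \<in> M"
      using x M(1) by (simp add: jacobson_radical_def)
    ultimately have "(\<one> \<ominus> x) \<oplus> x \<in> M"
      using maximal_right_ideal_D(5)[OF M(1)] xc by simp
    moreover have "(\<one> \<ominus> x) \<oplus> x = \<one>"
      using xc by algebra
    ultimately show False
      using maximal_right_ideal_D(2)[OF M(1)] by simp
  qed
  then show ?thesis
    using that by auto
qed

lemma jacobson_radical_mult_right:
  assumes "x \<in> jacobson_radical R" "r \<in> carrier R"
  shows "x \<otimes> r \<in> jacobson_radical R"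
  using assms by (simp add: jacobson_radical_def maximal_right_ideal_D(6))

text \<open>A right inverse \<open>u\<close> of \<open>1 - x\<close> equals
  \<open>1 - x(-u)\<close>, where \<open>x(-u)\<close> is again in the radical. So \<open>u\<close>
  has a right inverse \<open>v\<close> in addition to its left inverse \<open>1 - x\<close>; the two
  agree, and \<open>u\<close> is a two-sided inverse.\<close>

lemma one_minus_jacobson_radical_Units:
  assumes x: "x \<in> jacobson_radical R"
  shows "\<one> \<ominus> x \<in> Units R"
proof -
  have xc: "x \<in> carrier R"
    using x by (simp add: jacobson_radical_def)
  obtain u where u: "u \<in> carrier R" "(\<one> \<ominus> x) \<otimes> u = \<one>"
    using one_minus_mult_right_inverse[OF x] .
  have eq: "\<one> \<ominus> x \<otimes> \<ominus> u = u"
  proof -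
    have "(\<one> \<ominus> x) \<otimes> u \<oplus> x \<otimes> u = u"
      using xc u(1) by algebra
    then have "\<one> \<oplus> x \<otimes> u = u"
      by (simp add: u(2))
    moreover have "\<one> \<ominus> x \<otimes> \<ominus> u = \<one> \<oplus> x \<otimes> u"
      using xc u(1) by algebra
    ultimately show ?thesis
      by simp
  qed
  have "x \<otimes> \<ominus> u \<in> jacobson_radical R"
    using jacobson_radical_mult_right x u(1) by simp
  from one_minus_mult_right_inverse[OF this] obtain v where v: "v \<in> carrier R" "u \<otimes> v = \<one>"
    by (auto simp: eq)
  have "\<one> \<ominus> x = v"
    using inv_unique[of "\<one> \<ominus> x" u v] u v xc by simp
  with u v xc show ?thesis
    by (auto simp: Units_def)
qed

text \<open>For the converse, \<open>x \<notin> M\<close> gives \<open>1 = m + xr\<close> with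
  \<open>m \<in> M\<close>, so the unit \<open>1 - xr\<close> would lie in \<open>M\<close>. The
  criterion speaks of two-sided units, which are the same in the opposite ring; this is what makes
  the radical left-right symmetric.\<close>

lemma jacobson_radical_iff:
  assumes "x \<in> carrier R"
  shows "x \<in> jacobson_radical R \<longleftrightarrow> (\<forall>r\<in>carrier R. \<one> \<ominus> x \<otimes> r \<in> Units R)"
proof
  assume "x \<in> jacobson_radical R"
  then show "\<forall>r\<in>carrier R. \<one> \<ominus> x \<otimes> r \<in> Units R"
    using one_minus_jacobson_radical_Units jacobson_radical_mult_right by blast
next
  assume *: "\<forall>r\<in>carrier R. \<one> \<ominus> x \<otimes> r \<in> Units R"
  have "x \<in> M" if M: "maximal_right_ideal M R" for M
  proof (rule ccontr)
    assume "x \<notin> M"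
    then obtain m r where mr: "m \<in> M" "r \<in> carrier R" "\<one> = m \<oplus> x \<otimes> r"
      using maximal_right_ideal_comaximal[OF M assms] by blast
    have "m \<in> carrier R"
      using mr(1) maximal_right_ideal_D(3)[OF M] by auto
    then have "m \<oplus> x \<otimes> r \<ominus> x \<otimes> r = m"
      using mr(2) assms by algebra
    then have "\<one> \<ominus> x \<otimes> r = m"
      using mr(3) by simp
    then have "m \<in> Units R"
      using * mr(2) by metis
    then have "m \<otimes> inv m = \<one>" "inv m \<in> carrier R"
      by simp_all
    then show False
      using maximal_right_ideal_D(2,6)[OF M] mr(1) by metis
  qed
  then show "x \<in> jacobson_radical R"
    using assms by (simp add: jacobson_radical_def)
qed

text \<open>Jacobson's identity: if \<open>u\<close> inverts \<open>1 - ab\<close>, then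
  \<open>1 + bua\<close> inverts \<open>1 - ba\<close>.\<close>

lemma Units_one_minus_mult_commute:
  assumes "a \<in> carrier R" "b \<in> carrier R" "\<one> \<ominus> a \<otimes> b \<in> Units R"
  shows "\<one> \<ominus> b \<otimes> a \<in> Units R"
proof -
  define u where "u = inv (\<one> \<ominus> a \<otimes> b)"
  have u: "u \<in> carrier R" "(\<one> \<ominus> a \<otimes> b) \<otimes> u = \<one>" "u \<otimes> (\<one> \<ominus> a \<otimes> b) = \<one>"
    using assms(3) by (simp_all add: u_def)
  let ?v = "\<one> \<oplus> b \<otimes> u \<otimes> a"
  \<comment> \<open>The product is regrouped so that \<open>(1 - ab)u\<close> appears and can be
    replaced by \<open>\<one>\<close>.\<close>
  have "(\<one> \<ominus> b \<otimes> a) \<otimes> ?v = \<one> \<ominus> b \<otimes> a \<oplus> b \<otimes> ((\<one> \<ominus> a \<otimes> b) \<otimes> u) \<otimes> a"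
    using assms(1,2) u(1) by (simp add: ring_simprules)
  also have "\<dots> = \<one>"
    unfolding u(2) using assms(1,2) by (simp add: ring_simprules)
  finally have 1: "(\<one> \<ominus> b \<otimes> a) \<otimes> ?v = \<one>" .
  have "?v \<otimes> (\<one> \<ominus> b \<otimes> a) = \<one> \<ominus> b \<otimes> a \<oplus> b \<otimes> (u \<otimes> (\<one> \<ominus> a \<otimes> b)) \<otimes> a"
    using assms(1,2) u(1) by (simp add: ring_simprules)
  also have "\<dots> = \<one>"
    unfolding u(3) using assms(1,2) by (simp add: ring_simprules)
  finally have 2: "?v \<otimes> (\<one> \<ominus> b \<otimes> a) = \<one>" .
  show ?thesis
    using 1 2 assms(1,2) u(1) by (auto simp: Units_def)
qed

end

text \<open>Left-handed statements become right-handed ones here. A record update keeps the additive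
  structure literally the same, so additive notions transfer by unfolding.\<close>

definition opposite_ring :: "('a, 'b) ring_scheme \<Rightarrow> ('a, 'b) ring_scheme" where
  "opposite_ring R = R\<lparr>mult := \<lambda>x y. y \<otimes>\<^bsub>R\<^esub> x\<rparr>"

lemma opposite_ring_simps [simp]:
  "carrier (opposite_ring R) = carrier R"
  "x \<otimes>\<^bsub>opposite_ring R\<^esub> y = y \<otimes>\<^bsub>R\<^esub> x"
  "\<one>\<^bsub>opposite_ring R\<^esub> = \<one>\<^bsub>R\<^esub>"
  "\<zero>\<^bsub>opposite_ring R\<^esub> = \<zero>\<^bsub>R\<^esub>"
  "(\<oplus>\<^bsub>opposite_ring R\<^esub>) = (\<oplus>\<^bsub>R\<^esub>)"
  "x \<ominus>\<^bsub>opposite_ring R\<^esub> y = x \<ominus>\<^bsub>R\<^esub> y"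
  "Units (opposite_ring R) = Units R"
  "additive_subgroup I (opposite_ring R) = additive_subgroup I R"
  "opposite_ring (opposite_ring R) = R"
  by (auto simp: opposite_ring_def a_minus_def a_inv_def Units_def additive_subgroup_def)

context ring
begin

lemma ring_opposite_ring: "ring (opposite_ring R)"
proof (rule ringI)
  show "abelian_group (opposite_ring R)"
    using is_abelian_group
    by (simp add: abelian_group_def abelian_group_axioms_def abelian_monoid_def)
  show "Group.monoid (opposite_ring R)"
    by unfold_locales (simp_all add: m_assoc)
qed (simp_all add: l_distr r_distr)

text \<open>The unit criterion asks about \<open>1 - xr\<close> in one ring and
  \<open>1 - rx\<close> in the other; Jacobson's identity exchanges them.\<close>

lemma jacobson_radical_opposite_ring [simp]:
  "jacobson_radical (opposite_ring R) = jacobson_radical R"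
proof -
  interpret opp: ring "opposite_ring R"
    by (rule ring_opposite_ring)
  have "x \<in> jacobson_radical (opposite_ring R) \<longleftrightarrow> x \<in> jacobson_radical R"
    if "x \<in> carrier R" for x
    using that opp.jacobson_radical_iff[of x] jacobson_radical_iff[of x]
    by (auto intro: Units_one_minus_mult_commute)
  then show ?thesis
    by (auto simp: jacobson_radical_def)
qed

text \<open>Left absorption is right absorption in the opposite ring, whose radical is the same
  set.\<close>

lemma ideal_jacobson_radical: "ideal (jacobson_radical R) R"
proof -
  interpret opp: ring "opposite_ring R"
    by (rule ring_opposite_ring)
  have "right_ideal (jacobson_radical R) R"
    unfolding right_ideal_iff
    using maximal_right_ideal_D(4,5) jacobson_radical_mult_right
    by (auto simp: jacobson_radical_def)
  then interpret right_ideal "jacobson_radical R" R .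
  have "r \<otimes> x \<in> jacobson_radical R" if "x \<in> jacobson_radical R" "r \<in> carrier R" for x r
    using opp.jacobson_radical_mult_right[of x r] that by simp
  then show ?thesis
    by (simp add: idealI[OF ring_axioms a_subgroup] I_r_closed)
qed

end

subsection \<open>Rings in which every element is potent\<close>

context ring
begin

text \<open>A potency exponent is at least 2, so the power contains the factor
  \<open>y \<otimes> y\<close>. Hence a ring in which all elements are potent is reduced.\<close>

lemma potent_nilpotent_imp_zero:
  assumes "potent R y" "y \<otimes> y = \<zero>"
  shows "y = \<zero>"
proof -
  obtain m :: nat where m: "y \<in> carrier R" "m \<ge> 2" "y = y [^] m"
    using assms(1) by (auto simp: potent_def)
  then obtain k where "m = Suc (Suc k)"
    by (metis add_2_eq_Suc le_Suc_ex)
  then have "y [^] m = y [^] k \<otimes> (y \<otimes> y)"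
    using m(1) by (simp add: m_assoc)
  then show ?thesis
    using m assms(2) by simp
qed

text \<open>The elements \<open>er - ere\<close> and \<open>re - ere\<close> square to zero, so both
  vanish and \<open>er = ere = re\<close>.\<close>

lemma all_potent_idempotent_central:
  assumes pot: "\<And>a. a \<in> carrier R \<Longrightarrow> potent R a"
    and e: "e \<in> carrier R" "e \<otimes> e = e" and r: "r \<in> carrier R"
  shows "e \<otimes> r = r \<otimes> e"
proof -
  \<comment> \<open>Idempotence in the shape it takes inside right-nested products.\<close>
  have ee: "e \<otimes> (e \<otimes> x) = e \<otimes> x" if "x \<in> carrier R" for x
    using e that by (simp flip: m_assoc)
  have "(e \<otimes> r \<ominus> e \<otimes> r \<otimes> e) \<otimes> (e \<otimes> r \<ominus> e \<otimes> r \<otimes> e) = \<zero>"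
    using e r by (simp add: ring_simprules ee)
  then have 1: "e \<otimes> r \<ominus> e \<otimes> r \<otimes> e = \<zero>"
    by (rule potent_nilpotent_imp_zero[OF pot, rotated]) (use e r in simp)
  have "(r \<otimes> e \<ominus> e \<otimes> r \<otimes> e) \<otimes> (r \<otimes> e \<ominus> e \<otimes> r \<otimes> e) = \<zero>"
    using e r by (simp add: ring_simprules ee)
  then have 2: "r \<otimes> e \<ominus> e \<otimes> r \<otimes> e = \<zero>"
    by (rule potent_nilpotent_imp_zero[OF pot, rotated]) (use e r in simp)
  show ?thesis
    using 1 2 e r by (metis m_closed r_right_minus_eq)
qed

text \<open>The idempotent \<open>x\<^sup>n\<^sup>-\<^sup>1\<close> of \<open>x = x\<^sup>n\<close> is central, so
  \<open>r x = r x\<^sup>n\<^sup>-\<^sup>1 x = x (x\<^sup>n\<^sup>-\<^sup>2 r x)\<close>, where \<open>n = 2\<close> needs no separate treatment.\<close>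

lemma all_potent_left_mult_in_right_ideal:
  assumes pot: "\<And>a. a \<in> carrier R \<Longrightarrow> potent R a"
    and x: "x \<in> carrier R" and r: "r \<in> carrier R"
  obtains s where "s \<in> carrier R" "r \<otimes> x = x \<otimes> s"
proof -
  obtain m :: nat where m: "m \<ge> 2" "x = x [^] m"
    using pot[OF x] by (auto simp: potent_def)
  then obtain k where k: "m = Suc (Suc k)"
    by (metis add_2_eq_Suc le_Suc_ex)
  define e where "e = x [^] Suc k"
  have e: "e \<in> carrier R"
    using x by (simp add: e_def)
  have ex: "e \<otimes> x = x"
    using m k by (simp add: e_def)
  have xe: "e = x \<otimes> x [^] k"
    using x nat_pow_Suc2 by (simp add: e_def)
  \<comment> \<open>Only the second factor is expanded, so that \<open>e \<otimes> x\<close> can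
    collapse to \<open>x\<close>, leaving \<open>e\<close> again.\<close>
  have "e \<otimes> e = (e \<otimes> x) \<otimes> x [^] k"
    using x e by (subst (2) xe) (simp add: m_assoc)
  then have "e \<otimes> e = e"
    by (simp add: ex flip: xe)
  then have comm: "e \<otimes> r = r \<otimes> e"
    using all_potent_idempotent_central pot e r by blast
  have "r \<otimes> x = r \<otimes> (e \<otimes> x)"
    by (simp add: ex)
  also have "\<dots> = e \<otimes> r \<otimes> x"
    using comm e r x by (simp flip: m_assoc)
  also have "\<dots> = x \<otimes> (x [^] k \<otimes> r \<otimes> x)"
    using x r by (simp add: xe m_assoc)
  finally show ?thesis
    using that[of "x [^] k \<otimes> r \<otimes> x"] x r by simp
qed

end

subsection \<open>Periodicity modulo the Jacobson radical\<close>

context ideal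
begin

text \<open>Translates equations between powers in the quotient into membership in \<open>I\<close>.
  It serves potency with first exponent 1, and periodicity with arbitrary exponents.\<close>

lemma FactRing_nat_pow_eq_iff:
  assumes "a \<in> carrier R" "b \<in> carrier R"
  shows "(I +> a) [^]\<^bsub>R Quot I\<^esub> (m::nat) = (I +> b) [^]\<^bsub>R Quot I\<^esub> (n::nat)
    \<longleftrightarrow> a [^] m \<ominus> b [^] n \<in> I"
proof -
  interpret h: ring_hom_ring R "R Quot I" "(+>) I"
    by (rule rcos_ring_hom_ring)
  show ?thesis
    using assms quotient_eq_iff_same_a_r_cos[OF is_ideal]
    by (simp flip: h.hom_nat_pow)
qed

lemma carrier_FactRing: "carrier (R Quot I) = (+>) I ` carrier R"
  by (auto simp: FactRing_def A_RCOSETS_def')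

lemma potent_FactRing_iff:
  assumes "a \<in> carrier R"
  shows "potent (R Quot I) (I +> a) \<longleftrightarrow> (\<exists>m::nat. m \<ge> 2 \<and> a \<ominus> a [^] m \<in> I)"
proof -
  interpret h: ring_hom_ring R "R Quot I" "(+>) I"
    by (rule rcos_ring_hom_ring)
  have "I +> a = (I +> a) [^]\<^bsub>R Quot I\<^esub> m \<longleftrightarrow> a \<ominus> a [^] m \<in> I" for m :: nat
    using FactRing_nat_pow_eq_iff[OF assms assms, of 1 m] assms by simp
  then show ?thesis
    using assms by (simp add: potent_def)
qed

lemma periodic_ring_FactRing_iff:
  "periodic_ring (R Quot I) \<longleftrightarrow>
     (\<forall>a \<in> carrier R. \<exists>m n :: nat. m > 0 \<and> n > 0 \<and> m \<noteq> n \<and> a [^] m \<ominus> a [^] n \<in> I)"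
  by (simp add: periodic_ring_def carrier_FactRing FactRing_nat_pow_eq_iff)

end

section \<open>The equivalence for right quasi-duo rings\<close>

context ring
begin

lemma jacobson_radical_subset:
  "maximal_right_ideal M R \<Longrightarrow> jacobson_radical R \<subseteq> M"
  by (simp add: jacobson_radical_def subset_iff)

text \<open>If \<open>y \<notin> M\<close>, write \<open>1 = m + yr\<close>; then
  \<open>x = xm + (xy)r\<close>. The first summand is in \<open>M\<close> by left absorption, which
  is where two-sidedness enters.\<close>

lemma maximal_right_ideal_completely_prime:
  assumes M: "maximal_right_ideal M R" "ideal M R"
    and xy: "x \<in> carrier R" "y \<in> carrier R" "x \<otimes> y \<in> M"
  shows "x \<in> M \<or> y \<in> M"
proof (rule disjCI)
  interpret ideal M R by fact
  assume "y \<notin> M"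
  then obtain m r where mr: "m \<in> M" "r \<in> carrier R" "\<one> = m \<oplus> y \<otimes> r"
    using maximal_right_ideal_comaximal M(1) xy(2) by blast
  have "x = x \<otimes> (m \<oplus> y \<otimes> r)"
    using xy(1) by (simp flip: mr(3))
  also have "\<dots> = x \<otimes> m \<oplus> (x \<otimes> y) \<otimes> r"
    using xy mr(1,2) by (simp add: r_distr m_assoc)
  also have "\<dots> \<in> M"
    using xy mr I_l_closed I_r_closed by simp
  finally show "x \<in> M" .
qed

text \<open>With \<open>k = n - m\<close> and \<open>b = 1 - a^k\<close>, the hypothesis reads
  \<open>a^m b \<in> J\<close> and the goal \<open>ab \<in> J\<close>. In each maximal right ideal,
  complete primeness strips off the factors \<open>a\<close> one at a time.\<close>

lemma right_quasi_duo_periodic_mod_J: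
  assumes duo: "right_quasi_duo R" and a: "a \<in> carrier R"
    and mem: "a [^] (m::nat) \<ominus> a [^] (n::nat) \<in> jacobson_radical R" and less: "m < n"
  shows "a \<ominus> a [^] Suc (n - m) \<in> jacobson_radical R"
proof -
  define k where "k = n - m"
  define b where "b = \<one> \<ominus> a [^] k"
  have b: "b \<in> carrier R"
    using a by (simp add: b_def)
  have pow: "a [^] n = a [^] m \<otimes> a [^] k"
    using a less by (simp add: nat_pow_mult k_def)
  have fact: "a [^] m \<ominus> a [^] n = a [^] m \<otimes> b"
    unfolding pow b_def using a by (simp add: ring_simprules)
  have goal_eq: "a \<ominus> a [^] Suc k = a \<otimes> b"
    unfolding b_def nat_pow_Suc2[OF a] using a by (simp add: ring_simprules)
  have "a \<otimes> b \<in> M" if M: "maximal_right_ideal M R" for M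
  proof -
    have "ideal M R"
      using duo M by (simp add: right_quasi_duo_def)
    then interpret ideal M R .
    \<comment> \<open>The case \<open>j = 0\<close> yields \<open>b \<in> M\<close> directly, so
      \<open>m = 0\<close> is covered as well.\<close>
    have *: "a \<in> M \<or> b \<in> M" if "a [^] j \<otimes> b \<in> M" for j :: nat
      using that
    proof (induction j)
      case 0
      then show ?case
        using b by simp
    next
      case (Suc j)
      then have "a \<otimes> (a [^] j \<otimes> b) \<in> M"
        using a b nat_pow_Suc2[OF a] by (simp flip: m_assoc del: nat_pow_Suc)
      then show ?case
        using Suc.IH maximal_right_ideal_completely_prime[OF M \<open>ideal M R\<close> a, of "a [^] j \<otimes> b"] a b
        by auto
    qed
    have "a [^] m \<otimes> b \<in> M"
      using mem jacobson_radical_subset[OF M] by (auto simp: fact)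
    then show ?thesis
      using *[of m] I_r_closed[OF _ b, of a] I_l_closed[OF _ a, of b] by auto
  qed
  then show ?thesis
    unfolding k_def[symmetric] goal_eq using a b by (simp add: jacobson_radical_def)
qed

text \<open>Each coset is represented by a potent element of \<open>R\<close>, and the image of a
  potent element is potent.\<close>

lemma J_clean_like_imp_potent_FactRing:
  assumes "J_clean_like R" "A \<in> carrier (R Quot jacobson_radical R)"
  shows "potent (R Quot jacobson_radical R) A"
proof -
  interpret J: ideal "jacobson_radical R" R
    by (rule ideal_jacobson_radical)
  obtain a where a: "a \<in> carrier R" "A = jacobson_radical R +> a"
    using assms(2) by (auto simp: J.carrier_FactRing)
  then obtain p where p: "potent R p" "a \<ominus> p \<in> jacobson_radical R"
    using assms(1) by (auto simp: J_clean_like_def)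
  then obtain m :: nat where m: "p \<in> carrier R" "m \<ge> 2" "p = p [^] m"
    by (auto simp: potent_def)
  have "p \<ominus> p [^] m \<in> jacobson_radical R"
    unfolding m(3)[symmetric] using m(1) J.zero_closed by (simp add: minus_eq r_neg)
  then have "potent (R Quot jacobson_radical R) (jacobson_radical R +> p)"
    using J.potent_FactRing_iff m(1,2) by blast
  moreover have "A = jacobson_radical R +> p"
    using a p(2) m(1) quotient_eq_iff_same_a_r_cos[OF ideal_jacobson_radical] by simp
  ultimately show ?thesis
    by simp
qed

text \<open>In the quotient all elements are potent, so \<open>rx\<close> is congruent to some
  \<open>xs\<close> modulo the radical. The radical lies in \<open>M\<close>, as does
  \<open>xs\<close>, hence \<open>rx \<in> M\<close>.\<close>

lemma J_clean_like_imp_right_quasi_duo: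
  assumes "J_clean_like R"
  shows "right_quasi_duo R"
  unfolding right_quasi_duo_def
proof (intro allI impI)
  fix M
  assume M: "maximal_right_ideal M R"
  interpret J: ideal "jacobson_radical R" R
    by (rule ideal_jacobson_radical)
  interpret Q: ring "R Quot jacobson_radical R"
    by (rule J.quotient_is_ring)
  interpret h: ring_hom_ring R "R Quot jacobson_radical R" "(+>) (jacobson_radical R)"
    by (rule J.rcos_ring_hom_ring)
  interpret M: maximal_right_ideal M R by fact
  note D = maximal_right_ideal_D[OF M]
  have "r \<otimes> x \<in> M" if x: "x \<in> M" and r: "r \<in> carrier R" for x r
  proof -
    have xc: "x \<in> carrier R"
      using x D(3) by auto
    have pot: "\<And>A. A \<in> carrier (R Quot jacobson_radical R) \<Longrightarrow> potent (R Quot jacobson_radical R) A"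
      using J_clean_like_imp_potent_FactRing assms by blast
    obtain S where "S \<in> carrier (R Quot jacobson_radical R)"
      and "(jacobson_radical R +> r) \<otimes>\<^bsub>R Quot jacobson_radical R\<^esub> (jacobson_radical R +> x)
        = (jacobson_radical R +> x) \<otimes>\<^bsub>R Quot jacobson_radical R\<^esub> S"
      using Q.all_potent_left_mult_in_right_ideal[OF pot h.hom_closed[OF xc] h.hom_closed[OF r]]
      by blast
    then obtain s where s: "s \<in> carrier R"
      and "jacobson_radical R +> (r \<otimes> x) = jacobson_radical R +> (x \<otimes> s)"
      using xc r by (auto simp: J.carrier_FactRing)
    then have "r \<otimes> x \<ominus> x \<otimes> s \<in> jacobson_radical R"
      using xc r quotient_eq_iff_same_a_r_cos[OF ideal_jacobson_radical] by simp
    then have "(r \<otimes> x \<ominus> x \<otimes> s) \<oplus> x \<otimes> s \<in> M"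
      using jacobson_radical_subset[OF M] x s D(5,6) by blast
    moreover have "(r \<otimes> x \<ominus> x \<otimes> s) \<oplus> x \<otimes> s = r \<otimes> x"
      using r xc s by algebra
    ultimately show ?thesis
      by simp
  qed
  then show "ideal M R"
    by (simp add: idealI[OF ring_axioms M.a_subgroup] D(6))
qed

lemma J_clean_like_iff_right:
  "J_clean_like R \<longleftrightarrow>
     periodic_ring (R Quot jacobson_radical R) \<and> right_quasi_duo R \<and> potents_lift_mod_J R"
proof (intro iffI conjI)
  assume clean: "J_clean_like R"
  show "right_quasi_duo R"
    using clean by (rule J_clean_like_imp_right_quasi_duo)
  \<comment> \<open>Every element is congruent to a potent one, in particular those that are potent
    modulo the radical.\<close>
  show "potents_lift_mod_J R"
    using clean by (auto simp: J_clean_like_def potents_lift_mod_J_def)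
  interpret Q: ring "R Quot jacobson_radical R"
    by (rule ideal.quotient_is_ring[OF ideal_jacobson_radical])
  show "periodic_ring (R Quot jacobson_radical R)"
    unfolding periodic_ring_def
  proof
    fix A
    assume A: "A \<in> carrier (R Quot jacobson_radical R)"
    then obtain m :: nat where "m \<ge> 2" "A = A [^]\<^bsub>R Quot jacobson_radical R\<^esub> m"
      using J_clean_like_imp_potent_FactRing[OF clean] by (auto simp: potent_def)
    then have "m > 0" "(1::nat) > 0" "m \<noteq> 1"
      "A [^]\<^bsub>R Quot jacobson_radical R\<^esub> m = A [^]\<^bsub>R Quot jacobson_radical R\<^esub> (1::nat)"
      using A by simp_all
    then show "\<exists>m n :: nat. m > 0 \<and> n > 0 \<and> m \<noteq> n \<and>
        A [^]\<^bsub>R Quot jacobson_radical R\<^esub> m = A [^]\<^bsub>R Quot jacobson_radical R\<^esub> n"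
      by blast
  qed
next
  assume *: "periodic_ring (R Quot jacobson_radical R) \<and> right_quasi_duo R \<and> potents_lift_mod_J R"
  interpret J: ideal "jacobson_radical R" R
    by (rule ideal_jacobson_radical)
  show "J_clean_like R"
    unfolding J_clean_like_def
  proof
    fix a
    assume a: "a \<in> carrier R"
    then obtain m n :: nat where mn: "m \<noteq> n" "a [^] m \<ominus> a [^] n \<in> jacobson_radical R"
      using * by (auto simp: J.periodic_ring_FactRing_iff)
    \<comment> \<open>A change of sign allows the smaller exponent to be put first.\<close>
    have "\<ominus> (a [^] m \<ominus> a [^] n) = a [^] n \<ominus> a [^] m"
      using a by (simp add: ring_simprules)
    with mn(2) have "a [^] n \<ominus> a [^] m \<in> jacobson_radical R"
      using J.a_inv_closed by metis
    then obtain m' n' :: nat where "m' < n'" "a [^] m' \<ominus> a [^] n' \<in> jacobson_radical R"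
      using mn by (metis nat_neq_iff)
    \<comment> \<open>Since \<open>m' < n'\<close>, the exponent meets the bound 2 in the lifting
      condition, which then supplies the potent element.\<close>
    then have "a \<ominus> a [^] Suc (n' - m') \<in> jacobson_radical R" "Suc (n' - m') \<ge> 2"
      using right_quasi_duo_periodic_mod_J * a by auto
    then show "\<exists>p. potent R p \<and> a \<ominus> p \<in> jacobson_radical R"
      using * a unfolding potents_lift_mod_J_def by blast
  qed
qed

section \<open>Transfer to the opposite ring\<close>

lemma nat_pow_opposite_ring [simp]:
  assumes "x \<in> carrier R"
  shows "x [^]\<^bsub>opposite_ring R\<^esub> (n::nat) = x [^] n"
proof -
  interpret opp: ring "opposite_ring R"
    by (rule ring_opposite_ring)
  show ?thesis
  proof (induction n)
    \<comment> \<open>Powers append the new factor on the right, which in the opposite ring means on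
      the left in \<open>R\<close>; \<open>nat_pow_Suc2\<close> reconciles the two.\<close>
    case (Suc n)
    then show ?case
      using assms by (metis opp.nat_pow_Suc nat_pow_Suc2 opposite_ring_simps(2))
  qed simp
qed

lemma potent_opposite_ring [simp]: "potent (opposite_ring R) = potent R"
  by (auto simp: potent_def fun_eq_iff)

lemma J_clean_like_opposite_ring: "J_clean_like (opposite_ring R) = J_clean_like R"
  by (simp add: J_clean_like_def)

lemma potents_lift_mod_J_opposite_ring: "potents_lift_mod_J (opposite_ring R) = potents_lift_mod_J R"
  by (simp add: potents_lift_mod_J_def)

text \<open>The two quotients have reversed multiplications, so they are compared through the
  membership criterion, whose powers, differences and radical coincide in both rings.\<close>

lemma periodic_opposite_ring_mod_J:
  "periodic_ring (opposite_ring R Quot jacobson_radical (opposite_ring R)) =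
   periodic_ring (R Quot jacobson_radical R)"
proof -
  interpret opp: ring "opposite_ring R"
    by (rule ring_opposite_ring)
  show ?thesis
    using ideal.periodic_ring_FactRing_iff[OF opp.ideal_jacobson_radical]
      ideal.periodic_ring_FactRing_iff[OF ideal_jacobson_radical]
    by simp
qed

lemma right_ideal_opposite_ring: "right_ideal I (opposite_ring R) = left_ideal I R"
  by (simp add: right_ideal_def left_ideal_def right_ideal_axioms_def left_ideal_axioms_def
      ring_opposite_ring ring_axioms)

lemma maximal_right_ideal_opposite_ring:
  "maximal_right_ideal M (opposite_ring R) = maximal_left_ideal M R"
  by (simp add: maximal_right_ideal_def maximal_left_ideal_def maximal_right_ideal_axioms_def
      maximal_left_ideal_axioms_def right_ideal_opposite_ring)

lemma ideal_opposite_ring: "ideal I (opposite_ring R) = ideal I R"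
  by (auto simp: ideal_def ideal_axioms_def ring_opposite_ring ring_axioms)

lemma right_quasi_duo_opposite_ring: "right_quasi_duo (opposite_ring R) = left_quasi_duo R"
  by (simp add: right_quasi_duo_def left_quasi_duo_def maximal_right_ideal_opposite_ring
      ideal_opposite_ring)

end

theorem theorem4p8:
  fixes R :: "('a, 'b) ring_scheme"
  assumes "ring R"
  shows "(J_clean_like R \<longleftrightarrow>
            periodic_ring (R Quot jacobson_radical R) \<and>
            right_quasi_duo R \<and>
            potents_lift_mod_J R) \<and>
         (J_clean_like R \<longleftrightarrow>
            periodic_ring (R Quot jacobson_radical R) \<and>
            left_quasi_duo R \<and>
            potents_lift_mod_J R)"
proof -
  interpret ring R by fact
  show ?thesis
    \<comment> \<open>The right-handed equivalence is used twice: for \<open>R\<close>, and for its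
      opposite ring, where right quasi-duo means that \<open>R\<close> is left quasi-duo.\<close>
    using J_clean_like_iff_right ring.J_clean_like_iff_right[OF ring_opposite_ring]
    by (simp only: J_clean_like_opposite_ring potents_lift_mod_J_opposite_ring
        periodic_opposite_ring_mod_J right_quasi_duo_opposite_ring)
qed

end
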